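(* Let $N\ge 1$, let $T$ be the dyadic tree of depth $N$, $T^2=T\times T$, and let $\mu$ be a non-negative measure on $\partial T^2$. The following three conditions are equivalent: (a) (Carleson condition) $\sum_{R\in\mathcal R_E}\mu(R)^2\le C_a\,\mu(E)$ for all $E\subset\partial T^2$; (b) (restriction energy condition) $\mathcal E[\mu|E]\le C_b\,\mu(E)$ for all $E\subset\partial T^2$; (c) (hereditary Carleson condition) for every $E\subset\partial T^2$, the restriction $\mu|E$ is a $C_c$-Carleson measure. Equivalence is quantitative: if one of the conditions holds with some constant, then each of the other two holds with a constant depending only on that constant (not on $N$ or $\mu$).
   Context: $T$ is the finite dyadic tree of depth $N$: its nodes are the dyadic subintervals of $[0,1]$ of length $2^{-k}$, $0\le k\le N$; its boundary $\partial T$ is the set of dyadic intervals of length $2^{-N}$. The bi-tree is $T^2=T\times T$; a node $\alpha\in T^2$ is identified with the dyadic rectangle $R_\alpha\subset[0,1]^2$, and $\alpha\le\beta$ means $R_\alpha\subset R_\beta$. The boundary $\partial T^2=(\partial T)^2$ consists of the dyadic squares $\omega$ (also written $R_\omega$) of side $2^{-N}$. A measure $\mu$ on $\partial T^2$ assigns a finite mass $\mu(\omega)\ge0$ to each $\omega\in\partial T^2$. For a dyadic rectangle, $\mu(R_\alpha)=\sum_{\omega\in\partial T^2,\ \omega\le\alpha}\mu(\omega)$; for $E\subset\partial T^2$, $\mu(E)=\sum_{\omega\in E}\mu(\omega)$. For $E\subset\partial T^2$, $U_E=\bigcup_{\omega\in E}R_\omega$ and $\mathcal R_E$ is the collection of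 all dyadic rectangles $R$ (nodes of $T^2$) with $R\subset U_E$. The restriction $\mu|E$ is the measure with $(\mu|E)(\omega)=\mu(\omega)$ if $\omega\in E$ and $0$ otherwise. A measure $\nu$ on $\partial T^2$ is $C$-Carleson if $\sum_{R\in\mathcal R_F}\nu(R)^2\le C\,\nu(F)$ for all $F\subset\partial T^2$. The energy of a measure $\nu$ is $\mathcal E[\nu]=\sum_{\alpha\in T^2}\nu(R_\alpha)^2$. *)

theory Defs
  imports Complex_Main
begin

definition dyadic_intervals :: "nat \<Rightarrow> real set set" where
  "dyadic_intervals k = (\<lambda>m::nat. {real m / 2 ^ k .. (real m + 1) / 2 ^ k}) ` {..<2 ^ k}"

definition dyadic_tree :: "nat \<Rightarrow> real set set" where
  "dyadic_tree N = (\<Union>k\<le>N. dyadic_intervals k)"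

definition bitree :: "nat \<Rightarrow> (real set \<times> real set) set" where
  "bitree N = dyadic_tree N \<times> dyadic_tree N"

definition bitree_boundary :: "nat \<Rightarrow> (real set \<times> real set) set" where
  "bitree_boundary N = dyadic_intervals N \<times> dyadic_intervals N"

definition rect :: "real set \<times> real set \<Rightarrow> (real \<times> real) set" where
  "rect \<alpha> = fst \<alpha> \<times> snd \<alpha>"

definition node_le :: "real set \<times> real set \<Rightarrow> real set \<times> real set \<Rightarrow> bool" where
  "node_le \<alpha> \<beta> \<longleftrightarrow> rect \<alpha> \<subseteq> rect \<beta>"

text \<open>A measure on the boundary is a function on nodes of which only the values on
  \<^term>\<open>bitree_boundary N\<close> are ever used; the mass of a subset \<open>E\<close> of the boundary is
  \<^term>\<open>sum \<mu> E\<close>.\<close>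

definition boundary_measure :: "nat \<Rightarrow> (real set \<times> real set \<Rightarrow> real) \<Rightarrow> bool" where
  "boundary_measure N \<mu> \<longleftrightarrow> (\<forall>\<omega>\<in>bitree_boundary N. 0 \<le> \<mu> \<omega>)"

definition rect_mass :: "nat \<Rightarrow> (real set \<times> real set \<Rightarrow> real) \<Rightarrow> real set \<times> real set \<Rightarrow> real" where
  "rect_mass N \<mu> \<alpha> = sum \<mu> {\<omega> \<in> bitree_boundary N. node_le \<omega> \<alpha>}"

definition region :: "(real set \<times> real set) set \<Rightarrow> (real \<times> real) set" where
  "region E = (\<Union>\<omega>\<in>E. rect \<omega>)"

definition rects_in :: "nat \<Rightarrow> (real set \<times> real set) set \<Rightarrow> (real set \<times> real set) set" where
  "rects_in N E = {\<alpha> \<in> bitree N. rect \<alpha> \<subseteq> region E}"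

definition restrict_measure ::
    "(real set \<times> real set \<Rightarrow> real) \<Rightarrow> (real set \<times> real set) set \<Rightarrow> real set \<times> real set \<Rightarrow> real" where
  "restrict_measure \<mu> E \<omega> = (if \<omega> \<in> E then \<mu> \<omega> else 0)"

definition carleson :: "nat \<Rightarrow> real \<Rightarrow> (real set \<times> real set \<Rightarrow> real) \<Rightarrow> bool" where
  "carleson N C \<nu> \<longleftrightarrow>
    (\<forall>F \<subseteq> bitree_boundary N. (\<Sum>R\<in>rects_in N F. (rect_mass N \<nu> R)\<^sup>2) \<le> C * sum \<nu> F)"

definition energy :: "nat \<Rightarrow> (real set \<times> real set \<Rightarrow> real) \<Rightarrow> real" where
  "energy N \<nu> = (\<Sum>\<alpha>\<in>bitree N. (rect_mass N \<nu> \<alpha>)\<^sup>2)"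

definition restriction_energy_condition ::
    "nat \<Rightarrow> real \<Rightarrow> (real set \<times> real set \<Rightarrow> real) \<Rightarrow> bool" where
  "restriction_energy_condition N C \<mu> \<longleftrightarrow>
    (\<forall>E \<subseteq> bitree_boundary N. energy N (restrict_measure \<mu> E) \<le> C * sum \<mu> E)"

definition hereditary_carleson ::
    "nat \<Rightarrow> real \<Rightarrow> (real set \<times> real set \<Rightarrow> real) \<Rightarrow> bool" where
  "hereditary_carleson N C \<mu> \<longleftrightarrow>
    (\<forall>E \<subseteq> bitree_boundary N. carleson N C (restrict_measure \<mu> E))"

lemma finite_dyadic_intervals: "finite (dyadic_intervals k)"
  by (simp add: dyadic_intervals_def)

lemma finite_bitree: "finite (bitree N)"
  by (simp add: bitree_def dyadic_tree_def finite_dyadic_intervals)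

lemma finite_bitree_boundary: "finite (bitree_boundary N)"
  by (simp add: bitree_boundary_def finite_dyadic_intervals)

end

theory Submission
  imports Defs "HOL-Library.Product_Order" "HOL-Analysis.Convex"
begin

text \<open>
  The masses of the rectangles inside \<open>U\<^sub>F\<close> are unchanged when the measure is restricted to \<open>F\<close>.
  Hence the Carleson sum over \<open>F\<close> is at most the energy of the restriction to \<open>F\<close>, and (b) implies
  (c), which implies (a), with the same constant.

  All the work is in (a) implies (b). Among the boundary sets of positive mass take one, \<open>E\<close>, for
  which the ratio \<open>A = \<E>[\<mu>|E] / \<mu>(E)\<close> is largest, and put \<open>\<nu> = \<mu>|E\<close>. Let \<open>g \<alpha> = \<nu>(R\<^sub>\<alpha>)\<close> and let
  the potential \<open>V \<alpha>\<close> be the sum of \<open>g\<close> over the nodes above \<open>\<alpha>\<close>, so that the energy of \<open>\<nu>\<close> is the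
  sum of \<open>g\<^sup>2\<close>, and also the integral of \<open>V\<close> against \<open>\<nu>\<close>. The key fact
  (\<open>small_energy_le\<close>) is that the nodes with \<open>V \<le> A/400\<close> carry at most half of the energy.
  The remaining nodes are rectangles inside \<open>U\<^sub>F\<close>, where \<open>F\<close> consists of the
  boundary squares with \<open>V > A/400\<close>; so (a) gives \<open>A \<mu>(E) / 2 \<le> C \<mu>(F)\<close>. Finally \<open>\<mu>(F)\<close> is at most a
  constant times \<open>\<mu>(E)\<close>: integrate \<open>V > A/400\<close> against \<open>\<mu>|F\<close>, apply Cauchy-Schwarz to the mutual
  energy, and bound the energy of \<open>\<mu>|F\<close> by \<open>A \<mu>(F)\<close>, which is the maximality of \<open>A\<close>. Together these
  bound \<open>A\<close> by a multiple of \<open>C\<close> (\<open>restricted_energy_le\<close>).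

  The small energy bound would be immediate on a single tree. There the ancestors of a leaf form a
  chain, so the sum of \<open>g\<close> over those with \<open>V \<le> \<delta>\<close> is the value of \<open>V\<close> at the lowest of them and is at
  most \<open>\<delta>\<close>. On the bi-tree this maximum principle fails. It is replaced by the following
  decomposition (\<open>up_sum_biproduct_le\<close>). Let \<open>f\<close> be \<open>g\<close> cut off to \<open>V \<le> \<delta>\<close>, and fix a level
  \<open>M\<close> much larger than \<open>\<delta>\<close>. For a boundary point \<open>(x, y)\<close>, sum \<open>f\<close> over the nodes \<open>(a, b)\<close> above it,
  row by row. The rows \<open>b\<close> with \<open>V (x, b) < M\<close> are the ancestors of one \<open>c\<close>, and they contribute at most
  \<open>V (x, c) < M\<close>. In each other row the one-parameter theory applies: \<open>V\<close> climbs from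
  \<open>\<delta>\<close> to \<open>M\<close> below the support of \<open>f\<close>, and spreading the sum of \<open>f\<close> over that climb replaces \<open>f\<close> by a
  function \<open>\<phi>\<close> whose square norm is smaller by a factor of order \<open>\<delta>/M\<close>. Pairing with \<open>\<nu>\<close>, the first
  part costs \<open>M\<close> times the mass of \<open>\<nu>\<close>, and the second, by Cauchy-Schwarz, a small multiple of the energy.
\<close>

section \<open>Sums over ancestors and descendants\<close>

definition up_sum :: "'a::order set \<Rightarrow> ('a \<Rightarrow> real) \<Rightarrow> 'a \<Rightarrow> real" where
  "up_sum P f a = sum f {b\<in>P. a \<le> b}"

definition down_sum :: "'a::order set \<Rightarrow> ('a \<Rightarrow> real) \<Rightarrow> 'a \<Rightarrow> real" where
  "down_sum P f a = sum f {b\<in>P. b \<le> a}"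

lemma up_sum_nonneg: "(\<And>b. b \<in> P \<Longrightarrow> 0 \<le> f b) \<Longrightarrow> 0 \<le> up_sum P f a"
  by (auto simp: up_sum_def intro!: sum_nonneg)

lemma down_sum_nonneg: "(\<And>b. b \<in> P \<Longrightarrow> 0 \<le> f b) \<Longrightarrow> 0 \<le> down_sum P f a"
  by (auto simp: down_sum_def intro!: sum_nonneg)

lemma down_sum_mono:
  assumes "finite P" "\<And>b. b \<in> P \<Longrightarrow> f b \<le> g b"
  shows "down_sum P f a \<le> down_sum P g a"
  using assms by (auto simp: down_sum_def intro!: sum_mono)

lemma up_sum_antimono:
  assumes "finite P" "\<And>b. b \<in> P \<Longrightarrow> 0 \<le> f b" "a \<le> b"
  shows "up_sum P f b \<le> up_sum P f a"
  unfolding up_sum_def using assms by (intro sum_mono2) auto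

lemma member_le_up_sum:
  assumes "finite P" "\<And>b. b \<in> P \<Longrightarrow> 0 \<le> f b" "a \<in> P"
  shows "f a \<le> up_sum P f a"
  unfolding up_sum_def using assms by (intro member_le_sum) auto

text \<open>The two summation operators are adjoint to each other.\<close>
lemma sum_up_sum_eq_sum_down_sum:
  assumes "finite P" "finite Q"
  shows "(\<Sum>a\<in>P. w a * up_sum Q h a) = (\<Sum>b\<in>Q. h b * down_sum P w b)"
proof -
  have "(\<Sum>a\<in>P. w a * up_sum Q h a) = (\<Sum>a\<in>P. \<Sum>b\<in>Q. if a \<le> b then w a * h b else 0)"
    using assms by (simp add: up_sum_def sum_distrib_left sum.inter_filter if_distrib cong: if_cong)
  also have "\<dots> = (\<Sum>b\<in>Q. \<Sum>a\<in>P. if a \<le> b then w a * h b else 0)"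
    by (rule sum.swap)
  also have "\<dots> = (\<Sum>b\<in>Q. h b * down_sum P w b)"
    using assms by (simp add: down_sum_def sum_distrib_left sum.inter_filter if_distrib mult.commute cong: if_cong)
  finally show ?thesis .
qed

lemma up_sum_Times:
  "up_sum (P \<times> Q) f (a, b) = up_sum P (\<lambda>c. up_sum Q (\<lambda>d. f (c, d)) b) a"
proof -
  have "{p \<in> P \<times> Q. (a, b) \<le> p} = {c\<in>P. a \<le> c} \<times> {d\<in>Q. b \<le> d}" by auto
  then show ?thesis
    by (simp add: up_sum_def sum.cartesian_product)
qed

lemma down_sum_Times:
  "down_sum (P \<times> Q) f (a, b) = down_sum P (\<lambda>c. down_sum Q (\<lambda>d. f (c, d)) b) a"
proof -
  have "{p \<in> P \<times> Q. p \<le> (a, b)} = {c\<in>P. c \<le> a} \<times> {d\<in>Q. d \<le> b}" by auto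
  then show ?thesis
    by (simp add: down_sum_def sum.cartesian_product)
qed

section \<open>The one-parameter estimates\<close>

text \<open>Of the dyadic structure only this much enters the estimates: the nodes above a given node form a
  chain. Larger nodes are nearer to the root, and \<open>L\<close> carries the measures.\<close>
locale finite_forest =
  fixes T L :: "'a::order set"
  assumes finite_nodes: "finite T"
    and leaves_subset: "L \<subseteq> T"
    and above_chain: "\<lbrakk>x \<in> T; a \<in> T; b \<in> T; x \<le> a; x \<le> b\<rbrakk> \<Longrightarrow> a \<le> b \<or> b \<le> a"
begin

lemma finite_leaves: "finite L"
  using finite_nodes leaves_subset finite_subset by blast

lemma least_above:
  assumes "x \<in> T" "S \<subseteq> {a\<in>T. x \<le> a}" "S \<noteq> {}"
  obtains m where "m \<in> S" "\<And>s. s \<in> S \<Longrightarrow> m \<le> s"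
proof -
  have "finite S" using assms(2) finite_nodes finite_subset by fastforce
  then obtain m where m: "m \<in> S" "\<And>s. s \<in> S \<Longrightarrow> s \<le> m \<Longrightarrow> m = s"
    using finite_has_minimal[of S] assms(3) by blast
  have "m \<le> s" if "s \<in> S" for s
    using above_chain[of x m s] m that assms by auto
  then show ?thesis using m(1) that by blast
qed

text \<open>Any two nodes above \<open>x\<close> are comparable, so each term of the expanded product occurs in one of
  the two sums, according to which of its two nodes is lower.\<close>
lemma up_sum_mult_le:
  assumes x: "x \<in> T" and f: "\<And>a. a \<in> T \<Longrightarrow> 0 \<le> f a" and g: "\<And>a. a \<in> T \<Longrightarrow> 0 \<le> g a"
  shows "up_sum T f x * up_sum T g x
    \<le> up_sum T (\<lambda>a. f a * up_sum T g a) x + up_sum T (\<lambda>a. g a * up_sum T f a) x"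
proof -
  let ?X = "{a\<in>T. x \<le> a}"
  have fin: "finite ?X" using finite_nodes by simp
  have above: "up_sum T h a = (\<Sum>b\<in>?X. if a \<le> b then h b else 0)" if "a \<in> ?X" for h a
  proof -
    have "{b\<in>T. a \<le> b} = {b\<in>?X. a \<le> b}" using that by auto
    then show ?thesis by (simp only: up_sum_def sum.inter_filter[OF fin])
  qed
  have "up_sum T f x * up_sum T g x = (\<Sum>a\<in>?X. \<Sum>b\<in>?X. f a * g b)"
    by (simp add: up_sum_def sum_product)
  also have "\<dots> \<le> (\<Sum>a\<in>?X. \<Sum>b\<in>?X. (if a \<le> b then f a * g b else 0) + (if b \<le> a then f a * g b else 0))"
  proof (intro sum_mono)
    fix a b assume "a \<in> ?X" "b \<in> ?X"
    then have "a \<le> b \<or> b \<le> a" "0 \<le> f a * g b" using above_chain[of x a b] x f g by auto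
    then show "f a * g b \<le> (if a \<le> b then f a * g b else 0) + (if b \<le> a then f a * g b else 0)"
      by auto
  qed
  also have "\<dots> = (\<Sum>a\<in>?X. \<Sum>b\<in>?X. if a \<le> b then f a * g b else 0)
      + (\<Sum>b\<in>?X. \<Sum>a\<in>?X. if b \<le> a then f a * g b else 0)"
    by (subst (2) sum.swap) (simp add: sum.distrib)
  also have "(\<Sum>a\<in>?X. \<Sum>b\<in>?X. if a \<le> b then f a * g b else 0)
      = up_sum T (\<lambda>a. f a * up_sum T g a) x"
    unfolding up_sum_def[of T "\<lambda>a. f a * up_sum T g a"]
    by (intro sum.cong refl) (simp add: above sum_distrib_left if_distrib cong: if_cong)
  also have "(\<Sum>b\<in>?X. \<Sum>a\<in>?X. if b \<le> a then f a * g b else 0)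
      = up_sum T (\<lambda>a. g a * up_sum T f a) x"
    unfolding up_sum_def[of T "\<lambda>a. g a * up_sum T f a"]
    by (intro sum.cong refl) (simp add: above sum_distrib_left if_distrib mult.commute cong: if_cong)
  finally show ?thesis by simp
qed

text \<open>This is the maximum principle of a single tree. Write one factor \<open>G b\<close> as the mass of the leaves
  below \<open>b\<close> and exchange the sums: each leaf \<open>x\<close> meets the values \<open>G b\<close> along a chain, and their sum
  is at most the potential at the lowest admissible \<open>b\<close>, hence at most \<open>M\<close>.\<close>
lemma sum_square_down_sum_le:
  fixes \<sigma> :: "'a \<Rightarrow> real"
  assumes \<sigma>: "\<And>x. x \<in> L \<Longrightarrow> 0 \<le> \<sigma> x" and M: "0 \<le> M" and a: "a \<in> T"
  defines "G \<equiv> down_sum L \<sigma>"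
  shows "down_sum {b\<in>T. up_sum T G b \<le> M} (\<lambda>b. (G b)\<^sup>2) a \<le> M * G a"
proof -
  let ?S = "{b\<in>T. up_sum T G b \<le> M \<and> b \<le> a}"
  have G: "0 \<le> G b" for b unfolding G_def using \<sigma> by (rule down_sum_nonneg)
  have fin: "finite ?S" using finite_nodes by simp
  have "down_sum {b\<in>T. up_sum T G b \<le> M} (\<lambda>b. (G b)\<^sup>2) a = (\<Sum>b\<in>?S. G b * down_sum L \<sigma> b)"
    unfolding down_sum_def[of "{b\<in>T. up_sum T G b \<le> M}"]
    by (rule sum.cong) (auto simp: G_def power2_eq_square)
  also have "\<dots> = (\<Sum>x\<in>L. \<sigma> x * up_sum ?S G x)"
    using sum_up_sum_eq_sum_down_sum[OF finite_leaves fin, of \<sigma> G] by simp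
  also have "\<dots> \<le> (\<Sum>x\<in>L. if x \<le> a then \<sigma> x * M else 0)"
  proof (rule sum_mono)
    fix x assume x: "x \<in> L"
    have "up_sum ?S G x \<le> (if x \<le> a then M else 0)"
    proof (cases "{b\<in>?S. x \<le> b} = {}")
      case True
      then show ?thesis using M by (simp add: up_sum_def del: Collect_empty_eq)
    next
      case False
      then obtain m where m: "m \<in> {b\<in>?S. x \<le> b}" "\<And>s. s \<in> {b\<in>?S. x \<le> b} \<Longrightarrow> m \<le> s"
        using least_above[of x "{b\<in>?S. x \<le> b}"] x leaves_subset by blast
      have "up_sum ?S G x \<le> up_sum T G m"
        unfolding up_sum_def[of ?S] up_sum_def[of T G m]
        using m(2) G finite_nodes by (intro sum_mono2) auto
      also have "\<dots> \<le> M" using m by simp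
      finally show ?thesis using m by auto
    qed
    from mult_left_mono[OF this \<sigma>[OF x]]
    show "\<sigma> x * up_sum ?S G x \<le> (if x \<le> a then \<sigma> x * M else 0)"
      by (auto split: if_splits)
  qed
  also have "\<dots> = M * G a"
    using finite_leaves by (simp add: G_def down_sum_def sum.inter_filter[symmetric] sum_distrib_left mult.commute)
  finally show ?thesis .
qed

text \<open>A Carleson embedding with weight \<open>G\<^sup>2\<close> on the nodes of potential at most \<open>M\<close>, for functions
  that live where the potential is at most \<open>\<delta>\<close>. With \<open>X M\<close> for the left-hand side, expand the square
  by \<open>up_sum_mult_le\<close>, pass to the adjoint and use \<open>sum_square_down_sum_le\<close>: what remains is a sum over
  the support of \<open>f\<close>, and Cauchy-Schwarz there gives \<open>(X M)\<^sup>2 \<le> 4 M\<^sup>2 (\<Sum>f\<^sup>2) X \<delta>\<close>. The case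
  \<open>M = \<delta>\<close> bounds \<open>X \<delta>\<close>, and inserting this bound gives the general case.\<close>
lemma sum_square_mult_up_sum_le:
  fixes \<sigma> :: "'a \<Rightarrow> real"
  assumes \<sigma>: "\<And>x. x \<in> L \<Longrightarrow> 0 \<le> \<sigma> x"
  defines "G \<equiv> down_sum L \<sigma>"
  assumes \<delta>: "0 \<le> \<delta>" and M: "0 \<le> M"
    and f: "\<And>a. a \<in> T \<Longrightarrow> 0 \<le> f a"
    and supp: "\<And>a. a \<in> T \<Longrightarrow> \<delta> < up_sum T G a \<Longrightarrow> f a = 0"
  shows "(\<Sum>a\<in>{a\<in>T. up_sum T G a \<le> M}. (G a * up_sum T f a)\<^sup>2) \<le> 4 * M * \<delta> * (\<Sum>a\<in>T. (f a)\<^sup>2)"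
proof -
  let ?T = "\<lambda>M. {a\<in>T. up_sum T G a \<le> M}"
  let ?u = "up_sum T f"
  define X where "X = (\<lambda>M. \<Sum>a\<in>?T M. (G a * ?u a)\<^sup>2)"
  define F where "F = (\<Sum>a\<in>T. (f a)\<^sup>2)"
  have fin: "finite (?T M)" for M using finite_nodes by simp
  have G: "0 \<le> G b" for b unfolding G_def using \<sigma> by (rule down_sum_nonneg)
  have u: "0 \<le> ?u a" for a using f by (rule up_sum_nonneg)
  have F0: "0 \<le> F" unfolding F_def by (simp add: sum_nonneg)
  have X0: "0 \<le> X M" for M unfolding X_def by (simp add: sum_nonneg)
  have step: "(X M)\<^sup>2 \<le> 4 * M\<^sup>2 * F * X \<delta>" if M: "0 \<le> M" for M
  proof -
    have "X M \<le> (\<Sum>a\<in>?T M. 2 * ((G a)\<^sup>2 * up_sum T (\<lambda>a. f a * ?u a) a))"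
      unfolding X_def
    proof (rule sum_mono)
      fix a assume "a \<in> ?T M"
      then have "?u a * ?u a \<le> 2 * up_sum T (\<lambda>a. f a * ?u a) a"
        using up_sum_mult_le[of a f f] f by auto
      then have "(G a)\<^sup>2 * (?u a * ?u a) \<le> (G a)\<^sup>2 * (2 * up_sum T (\<lambda>a. f a * ?u a) a)"
        by (rule mult_left_mono) simp
      then show "(G a * ?u a)\<^sup>2 \<le> 2 * ((G a)\<^sup>2 * up_sum T (\<lambda>a. f a * ?u a) a)"
        by (simp add: power2_eq_square algebra_simps)
    qed
    also have "\<dots> = 2 * (\<Sum>b\<in>T. f b * ?u b * down_sum (?T M) (\<lambda>a. (G a)\<^sup>2) b)"
      by (simp add: sum_distrib_left[symmetric] sum_up_sum_eq_sum_down_sum[OF fin finite_nodes])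
    also have "\<dots> \<le> 2 * (\<Sum>b\<in>T. f b * ?u b * (M * G b))"
      unfolding G_def using f u M \<sigma>
      by (intro mult_left_mono sum_mono sum_square_down_sum_le) auto
    also have "\<dots> = 2 * M * (\<Sum>b\<in>T. f b * (G b * ?u b))"
      by (simp add: sum_distrib_left algebra_simps)
    also have "(\<Sum>b\<in>T. f b * (G b * ?u b)) = (\<Sum>b\<in>?T \<delta>. f b * (G b * ?u b))"
      using finite_nodes by (intro sum.mono_neutral_right) (auto simp: not_le supp)
    finally have "(X M)\<^sup>2 \<le> (2 * M * (\<Sum>b\<in>?T \<delta>. f b * (G b * ?u b)))\<^sup>2"
      using X0 by (intro power_mono)
    also have "\<dots> = 4 * M\<^sup>2 * (\<Sum>b\<in>?T \<delta>. f b * (G b * ?u b))\<^sup>2"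
      by (simp add: power_mult_distrib)
    also have "\<dots> \<le> 4 * M\<^sup>2 * ((\<Sum>b\<in>?T \<delta>. (f b)\<^sup>2) * X \<delta>)"
      unfolding X_def by (intro mult_left_mono Cauchy_Schwarz_ineq_sum) auto
    also have "\<dots> \<le> 4 * M\<^sup>2 * (F * X \<delta>)"
      unfolding F_def using finite_nodes X0
      by (intro mult_left_mono mult_right_mono sum_mono2) auto
    finally show ?thesis by (simp add: algebra_simps)
  qed
  have X\<delta>: "X \<delta> \<le> 4 * \<delta>\<^sup>2 * F"
  proof (cases "X \<delta> = 0")
    case False
    then have "0 < X \<delta>" using X0[of \<delta>] by simp
    then show ?thesis using step[OF \<delta>] by (simp add: power2_eq_square)
  qed (use F0 in simp)
  have "(X M)\<^sup>2 \<le> 4 * M\<^sup>2 * F * (4 * \<delta>\<^sup>2 * F)"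
    using step[OF M] X\<delta> F0 by (meson mult_left_mono mult_nonneg_nonneg order_trans zero_le_numeral zero_le_power2)
  also have "\<dots> = (4 * M * \<delta> * F)\<^sup>2" by (simp add: power2_eq_square)
  finally have "X M \<le> 4 * M * \<delta> * F"
    using M \<delta> F0 by (intro power2_le_imp_le[of "X M"]) auto
  then show ?thesis by (simp add: X_def F_def)
qed

text \<open>Above a node \<open>x\<close> of potential at least \<open>M\<close>, let \<open>m\<close> be the lowest node of potential at most \<open>M\<close>.
  The support of \<open>f\<close> lies above \<open>m\<close>, so \<open>f\<close> has the same ancestor sum at \<open>m\<close> as at \<open>x\<close>. At \<open>m\<close> the
  product bound \<open>up_sum_mult_le\<close> applies; its first term, \<open>f\<close> times the potential, absorbs only \<open>\<delta>\<close>
  times the ancestor sum. The other loss of \<open>\<delta>\<close> arises because the potential at \<open>m\<close> may stop short of \<open>M\<close>: its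
  increments are values of \<open>G\<close> below the support of \<open>f\<close>, and \<open>G\<close> increases towards the root, so each
  increment is at most \<open>\<delta>\<close>.\<close>
lemma up_sum_le_up_sum_truncated:
  assumes G0: "\<And>a. a \<in> T \<Longrightarrow> 0 \<le> G a"
    and Gmono: "\<And>a b. a \<in> T \<Longrightarrow> b \<in> T \<Longrightarrow> a \<le> b \<Longrightarrow> G a \<le> G b"
    and f: "\<And>a. a \<in> T \<Longrightarrow> 0 \<le> f a"
    and supp: "\<And>a. a \<in> T \<Longrightarrow> \<delta> < up_sum T G a \<Longrightarrow> f a = 0"
    and \<delta>: "0 \<le> \<delta>" "2 * \<delta> < M"
    and x: "x \<in> T" "M \<le> up_sum T G x"
  shows "(M - 2 * \<delta>) * up_sum T f x
    \<le> up_sum T (\<lambda>a. if up_sum T G a \<le> M then G a * up_sum T f a else 0) x" (is "_ \<le> ?R")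
proof -
  let ?V = "up_sum T G" and ?u = "up_sum T f"
  have u: "0 \<le> ?u a" for a using f by (rule up_sum_nonneg)
  have Vanti: "?V b \<le> ?V a" if "a \<le> b" for a b
    using up_sum_antimono[OF finite_nodes G0 that] .
  have R0: "0 \<le> ?R" using G0 u by (intro up_sum_nonneg) auto
  show ?thesis
  proof (cases "\<exists>b\<in>T. x \<le> b \<and> f b \<noteq> 0")
    case False
    then have "?u x = 0" unfolding up_sum_def by (intro sum.neutral) auto
    then show ?thesis using R0 by simp
  next
    case True
    then obtain b where b: "b \<in> T" "x \<le> b" "f b \<noteq> 0" by blast
    have Vb: "?V b \<le> \<delta>" using supp b not_le by blast
    let ?S = "{c\<in>T. x \<le> c \<and> ?V c \<le> M}"
    have bS: "b \<in> ?S" using b Vb \<delta> by auto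
    obtain m where m: "m \<in> ?S" "\<And>s. s \<in> ?S \<Longrightarrow> m \<le> s"
      using least_above[of x ?S] x bS by blast
    have Vm: "M - \<delta> \<le> ?V m"
    proof (cases "?V x \<le> M")
      case True
      then have "x \<in> ?S" using x by auto
      then have "m \<le> x" by (rule m(2))
      from Vanti[OF this] show ?thesis using x(2) \<delta>(1) by linarith
    next
      case False
      \<comment> \<open>The node \<open>p\<close> just below \<open>m\<close> already has potential above \<open>M\<close>.\<close>
      let ?S' = "{c\<in>T. x \<le> c \<and> M < ?V c}"
      have "finite ?S'" "?S' \<noteq> {}" using x False finite_nodes by auto
      then obtain p where p: "p \<in> ?S'" "\<And>s. s \<in> ?S' \<Longrightarrow> p \<le> s \<Longrightarrow> p = s"
        using finite_has_maximal[of ?S'] by blast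
      have "?V p \<le> sum G (insert p {c\<in>T. m \<le> c})"
        unfolding up_sum_def
      proof (rule sum_mono2)
        show "{b \<in> T. p \<le> b} \<subseteq> insert p {c \<in> T. m \<le> c}"
        proof
          fix c assume c: "c \<in> {b \<in> T. p \<le> b}"
          show "c \<in> insert p {c \<in> T. m \<le> c}"
          proof (cases "c = p")
            case False
            then have "c \<notin> ?S'" using p(2)[of c] c by blast
            moreover have "x \<le> c" using c p(1) by auto
            ultimately have "c \<in> ?S" using c by auto
            then show ?thesis using m(2) by blast
          qed simp
        qed
      qed (use finite_nodes G0 p in auto)
      also have "\<dots> \<le> G p + ?V m"
        using finite_nodes G0[of p] p(1) by (auto simp: up_sum_def sum.insert_if)
      also have "G p \<le> \<delta>"
      proof -
        have "p \<le> b"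
          using above_chain[of x p b] x p b Vanti[of b p] Vb \<delta> by auto
        then have "G p \<le> G b" using Gmono p b by auto
        also have "\<dots> \<le> ?V b" by (rule member_le_up_sum[OF finite_nodes G0 b(1)])
        finally show ?thesis using Vb by simp
      qed
      finally show ?thesis using p(1) by auto
    qed
    have "?u x \<le> ?u m"
    proof -
      have "?u x = sum f {c\<in>T. x \<le> c \<and> m \<le> c}"
        unfolding up_sum_def
      proof (rule sum.mono_neutral_right)
        show "\<forall>c\<in>{b \<in> T. x \<le> b} - {c \<in> T. x \<le> c \<and> m \<le> c}. f c = 0"
        proof
          fix c assume c: "c \<in> {b \<in> T. x \<le> b} - {c \<in> T. x \<le> c \<and> m \<le> c}"
          then have "c \<notin> ?S" using m(2) by blast
          then have "\<delta> < ?V c" using c \<delta> by auto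
          then show "f c = 0" using supp c by blast
        qed
      qed (use finite_nodes in auto)
      also have "\<dots> \<le> ?u m"
        unfolding up_sum_def using finite_nodes f by (intro sum_mono2) auto
      finally show ?thesis .
    qed
    then have "(M - 2 * \<delta>) * ?u x \<le> (M - 2 * \<delta>) * ?u m"
      using \<delta> by (intro mult_left_mono) auto
    also have "\<dots> \<le> (?V m - \<delta>) * ?u m"
      using Vm u by (intro mult_right_mono) auto
    also have "\<dots> \<le> up_sum T (\<lambda>a. G a * ?u a) m"
    proof -
      have "up_sum T (\<lambda>a. f a * ?V a) m \<le> \<delta> * ?u m"
        unfolding up_sum_def[of T "\<lambda>a. f a * ?V a"] up_sum_def[of T f] sum_distrib_left
      proof (rule sum_mono)
        fix c assume c: "c \<in> {b \<in> T. m \<le> b}"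
        then have "f c = 0 \<or> ?V c \<le> \<delta>" using supp not_le by blast
        then show "f c * up_sum T G c \<le> \<delta> * f c" using f[of c] c \<delta>
          by (auto simp: mult.commute[of \<delta>] intro: mult_left_mono)
      qed
      moreover have "?u m * ?V m \<le> up_sum T (\<lambda>a. f a * ?V a) m + up_sum T (\<lambda>a. G a * ?u a) m"
        using m(1) f G0 by (intro up_sum_mult_le) auto
      ultimately show ?thesis by (simp add: algebra_simps)
    qed
    also have "\<dots> \<le> ?R"
    proof -
      have "up_sum T (\<lambda>a. G a * ?u a) m
          = up_sum T (\<lambda>a. if ?V a \<le> M then G a * ?u a else 0) m"
        unfolding up_sum_def[of T _ m]
      proof (rule sum.cong)
        fix c assume "c \<in> {b \<in> T. m \<le> b}"
        then have "?V c \<le> ?V m" by (intro Vanti) simp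
        then show "G c * ?u c = (if ?V c \<le> M then G c * ?u c else 0)" using m(1) by simp
      qed simp
      also have "\<dots> \<le> ?R"
        using m(1) G0 u by (intro up_sum_antimono finite_nodes) auto
      finally show ?thesis .
    qed
    finally show ?thesis .
  qed
qed


section \<open>The small energy bound on the bi-tree\<close>
definition bipotential :: "('a \<times> 'a \<Rightarrow> real) \<Rightarrow> 'a \<times> 'a \<Rightarrow> real" where
  "bipotential \<nu> = up_sum (T \<times> T) (down_sum (L \<times> L) \<nu>)"

text \<open>For a fixed second coordinate \<open>b\<close>, the function \<open>bipotential \<nu> (\<cdot>, b)\<close> is the one-parameter
  potential of the measure \<open>\<sigma> b\<close> on the leaves of the first tree, which collects the masses over
  the second coordinates below the ancestors of \<open>b\<close>, with multiplicity. So the one-parameter estimates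
  apply in every row \<open>b\<close> and yield \<open>\<phi>\<close>.

  Over a boundary point \<open>(x, y)\<close> they dominate \<open>f\<close> in the rows whose potential at \<open>x\<close> has reached
  \<open>M\<close>. The rows where it has not are the ancestors of a lowest one, \<open>m\<close>, so
  \<open>f \<le> g\<close> sums over them to at most \<open>bipotential \<nu> (x, m) < M\<close>. This additive \<open>M\<close> stands in for the
  missing maximum principle.\<close>
lemma up_sum_biproduct_le:
  fixes \<nu> :: "'a \<times> 'a \<Rightarrow> real"
  assumes \<nu>: "\<And>\<omega>. \<omega> \<in> L \<times> L \<Longrightarrow> 0 \<le> \<nu> \<omega>"
    and \<delta>: "0 \<le> \<delta>" "2 * \<delta> < M"
  defines "g \<equiv> down_sum (L \<times> L) \<nu>"
  defines "f \<equiv> \<lambda>p. if bipotential \<nu> p \<le> \<delta> then g p else 0"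
  shows "\<exists>\<phi>.
    (M - 2 * \<delta>)\<^sup>2 * (\<Sum>p\<in>T \<times> T. (\<phi> p)\<^sup>2) \<le> 4 * M * \<delta> * (\<Sum>p\<in>T \<times> T. (f p)\<^sup>2) \<and>
    (\<forall>\<omega>\<in>L \<times> L. up_sum (T \<times> T) f \<omega> \<le> up_sum (T \<times> T) \<phi> \<omega> + M)"
proof -
  let ?V = "bipotential \<nu>"
  define \<sigma> where "\<sigma> b x = up_sum T (\<lambda>c. down_sum L (\<lambda>y. \<nu> (x, y)) c) b" for b x
  define G where "G b = down_sum L (\<sigma> b)" for b
  define u where "u b = up_sum T (\<lambda>a. f (a, b))" for b
  define \<phi> where "\<phi> p = (if ?V p \<le> M then G (snd p) (fst p) * u (snd p) (fst p) / (M - 2 * \<delta>) else 0)" for p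
  have M: "0 < M" using \<delta> by linarith
  have \<sigma>0: "0 \<le> \<sigma> b x" if "x \<in> L" for b x
    unfolding \<sigma>_def using \<nu> that by (intro up_sum_nonneg down_sum_nonneg) auto
  have G0: "0 \<le> G b a" for a b unfolding G_def using \<sigma>0 by (rule down_sum_nonneg)
  have g0: "0 \<le> g p" for p unfolding g_def using \<nu> by (rule down_sum_nonneg)
  have f0: "0 \<le> f p" and fg: "f p \<le> g p" for p using g0 by (auto simp: f_def)
  have u0: "0 \<le> u b a" for a b unfolding u_def using f0 by (rule up_sum_nonneg)
  have G_eq: "G b = (\<lambda>a. up_sum T (\<lambda>c. g (a, c)) b)" for b
  proof
    show "G b a = up_sum T (\<lambda>c. g (a, c)) b" for a
      unfolding G_def \<sigma>_def g_def down_sum_Times down_sum_def[of L _ a] up_sum_def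
      by (rule sum.swap)
  qed
  have V_eq: "up_sum T (G b) a = ?V (a, b)" for a b
    by (simp add: bipotential_def up_sum_Times G_eq flip: g_def)
  have \<phi>0: "0 \<le> \<phi> p" for p using G0 u0 \<delta> by (simp add: \<phi>_def)
  have supp: "f (a, b) = 0" if "\<delta> < up_sum T (G b) a" for a b
    using that by (simp add: f_def V_eq)
  show ?thesis
  proof (intro exI[of _ \<phi>] conjI ballI)
    have "(M - 2 * \<delta>)\<^sup>2 * (\<Sum>p\<in>T \<times> T. (\<phi> p)\<^sup>2) = (\<Sum>p\<in>T \<times> T. ((M - 2 * \<delta>) * \<phi> p)\<^sup>2)"
      by (simp add: sum_distrib_left power_mult_distrib)
    also have "\<dots> = (\<Sum>p\<in>T \<times> T. if ?V p \<le> M then (G (snd p) (fst p) * u (snd p) (fst p))\<^sup>2 else 0)"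
      using \<delta> by (intro sum.cong) (auto simp: \<phi>_def)
    also have "\<dots> = (\<Sum>b\<in>T. \<Sum>a\<in>T. if ?V (a, b) \<le> M then (G b a * u b a)\<^sup>2 else 0)"
      by (subst sum.swap) (simp add: sum.cartesian_product split_def)
    also have "\<dots> = (\<Sum>b\<in>T. \<Sum>a\<in>{a\<in>T. up_sum T (G b) a \<le> M}. (G b a * u b a)\<^sup>2)"
      using finite_nodes by (simp only: V_eq sum.inter_filter)
    also have "\<dots> \<le> (\<Sum>b\<in>T. 4 * M * \<delta> * (\<Sum>a\<in>T. (f (a, b))\<^sup>2))"
      unfolding G_def u_def
      by (intro sum_mono sum_square_mult_up_sum_le \<sigma>0 f0 supp) (use M \<delta> in \<open>auto simp: G_def\<close>)
    also have "\<dots> = 4 * M * \<delta> * (\<Sum>p\<in>T \<times> T. (f p)\<^sup>2)"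
      by (subst sum_distrib_left[symmetric], subst sum.swap) (simp add: sum.cartesian_product split_def)
    finally show "(M - 2 * \<delta>)\<^sup>2 * (\<Sum>p\<in>T \<times> T. (\<phi> p)\<^sup>2) \<le> 4 * M * \<delta> * (\<Sum>p\<in>T \<times> T. (f p)\<^sup>2)" .
  next
    fix \<omega> assume "\<omega> \<in> L \<times> L"
    then obtain x y where \<omega>: "\<omega> = (x, y)" and x: "x \<in> T" and y: "y \<in> T"
      using leaves_subset by auto
    have swap: "up_sum (T \<times> T) h (x, y) = (\<Sum>b\<in>{b\<in>T. y \<le> b}. up_sum T (\<lambda>a. h (a, b)) x)" for h
      unfolding up_sum_Times unfolding up_sum_def by (rule sum.swap)
    let ?big = "{b\<in>T. y \<le> b \<and> M \<le> ?V (x, b)}" and ?small = "{b\<in>T. y \<le> b \<and> ?V (x, b) < M}"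
    have split: "{b\<in>T. y \<le> b} = ?big \<union> ?small" by auto
    have "up_sum (T \<times> T) f \<omega> = (\<Sum>b\<in>?big. u b x) + (\<Sum>b\<in>?small. u b x)"
      unfolding \<omega> swap u_def[symmetric] split
      by (rule sum.union_disjoint) (use finite_nodes in auto)
    also have "(\<Sum>b\<in>?big. u b x) \<le> (\<Sum>b\<in>?big. up_sum T (\<lambda>a. \<phi> (a, b)) x)"
    proof (rule sum_mono)
      fix b assume b: "b \<in> ?big"
      have "(M - 2 * \<delta>) * u b x
          \<le> up_sum T (\<lambda>a. if up_sum T (G b) a \<le> M then G b a * u b a else 0) x"
        unfolding u_def
      proof (rule up_sum_le_up_sum_truncated[OF G0 _ f0 supp \<delta> x])
        fix a a' :: 'a assume "a \<le> a'"
        then show "G b a \<le> G b a'"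
          unfolding G_def down_sum_def using finite_leaves \<sigma>0
          by (intro sum_mono2) auto
      qed (use b V_eq in auto)
      also have "\<dots> = (M - 2 * \<delta>) * up_sum T (\<lambda>a. \<phi> (a, b)) x"
      proof -
        have "(\<lambda>a. if up_sum T (G b) a \<le> M then G b a * u b a else 0) = (\<lambda>a. (M - 2 * \<delta>) * \<phi> (a, b))"
          using \<delta> by (auto simp: \<phi>_def V_eq)
        then show ?thesis by (simp only: up_sum_def sum_distrib_left)
      qed
      finally show "u b x \<le> up_sum T (\<lambda>a. \<phi> (a, b)) x" using \<delta> by simp
    qed
    also have "(\<Sum>b\<in>?big. up_sum T (\<lambda>a. \<phi> (a, b)) x) \<le> up_sum (T \<times> T) \<phi> \<omega>"
      unfolding \<omega> swap using finite_nodes \<phi>0 by (intro sum_mono2 up_sum_nonneg) auto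
    also have "(\<Sum>b\<in>?small. u b x) \<le> M"
    proof (cases "?small = {}")
      case False
      then obtain m where m: "m \<in> ?small" "\<And>s. s \<in> ?small \<Longrightarrow> m \<le> s"
        using least_above[of y ?small] y by blast
      have "(\<Sum>b\<in>?small. u b x) \<le> (\<Sum>b\<in>{b\<in>T. m \<le> b}. up_sum T (\<lambda>a. g (a, b)) x)"
      proof (rule order_trans[OF sum_mono2 sum_mono])
        show "?small \<subseteq> {b\<in>T. m \<le> b}" using m(2) by auto
        show "u b x \<le> up_sum T (\<lambda>a. g (a, b)) x" for b
          unfolding u_def up_sum_def by (intro sum_mono fg)
      qed (use finite_nodes u0 in auto)
      also have "\<dots> = ?V (x, m)"
        unfolding bipotential_def g_def[symmetric]
        unfolding up_sum_Times unfolding up_sum_def by (rule sum.swap)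
      finally show ?thesis using m(1) by simp
    next
      case True
      then show ?thesis using M by (simp only: sum.empty less_imp_le)
    qed
    finally show "up_sum (T \<times> T) f \<omega> \<le> up_sum (T \<times> T) \<phi> \<omega> + M" by simp
  qed
qed

text \<open>Integrate \<open>up_sum_biproduct_le\<close> against \<open>\<nu>\<close>, with \<open>\<delta> = M / 100\<close>. The ratio 100 is
  chosen so that \<open>4 M \<delta> / (M - 2 \<delta>)\<^sup>2 \<le> 1 / 16\<close>; Cauchy-Schwarz then turns the pairing of \<open>\<phi>\<close>
  with \<open>g\<close> into a quarter of the energy.\<close>
lemma small_energy_le:
  fixes \<nu> :: "'a \<times> 'a \<Rightarrow> real"
  assumes \<nu>: "\<And>\<omega>. \<omega> \<in> L \<times> L \<Longrightarrow> 0 \<le> \<nu> \<omega>" and M: "0 < M"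
  defines "g \<equiv> down_sum (L \<times> L) \<nu>"
  shows "(\<Sum>p\<in>{p\<in>T \<times> T. bipotential \<nu> p \<le> M / 100}. (g p)\<^sup>2)
    \<le> (\<Sum>p\<in>T \<times> T. (g p)\<^sup>2) / 4 + M * sum \<nu> (L \<times> L)"
proof -
  define f where "f = (\<lambda>p. if bipotential \<nu> p \<le> M / 100 then g p else 0)"
  have finP: "finite (T \<times> T)" and finB: "finite (L \<times> L)"
    using finite_nodes finite_leaves by auto
  have \<delta>: "0 \<le> M / 100" "2 * (M / 100) < M" using M by simp_all
  obtain \<phi> where
    "(M - 2 * (M / 100))\<^sup>2 * (\<Sum>p\<in>T \<times> T. (\<phi> p)\<^sup>2) \<le> 4 * M * (M / 100) * (\<Sum>p\<in>T \<times> T. (f p)\<^sup>2) \<and>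
    (\<forall>\<omega>\<in>L \<times> L. up_sum (T \<times> T) f \<omega> \<le> up_sum (T \<times> T) \<phi> \<omega> + M)"
    using up_sum_biproduct_le[OF \<nu> \<delta>] unfolding f_def g_def by (rule exE)
  note \<phi> = conjunct1[OF this] bspec[OF conjunct2[OF this]]
  define X where "X = (\<Sum>p\<in>T \<times> T. (f p)\<^sup>2)"
  define E where "E = (\<Sum>p\<in>T \<times> T. (g p)\<^sup>2)"
  have "X \<le> E" unfolding X_def E_def f_def by (intro sum_mono) auto
  have X0: "0 \<le> X" and E0: "0 \<le> E" unfolding X_def E_def by (simp_all add: sum_nonneg)
  have "M\<^sup>2 * ((98/100)\<^sup>2 * (\<Sum>p\<in>T \<times> T. (\<phi> p)\<^sup>2)) \<le> M\<^sup>2 * (4/100 * X)"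
    using \<phi>(1) by (simp add: X_def power2_eq_square field_simps)
  then have "(98/100)\<^sup>2 * (\<Sum>p\<in>T \<times> T. (\<phi> p)\<^sup>2) \<le> 4/100 * X"
    using M by (simp only: mult_le_cancel_left_pos zero_less_power)
  then have \<phi>E: "(\<Sum>p\<in>T \<times> T. (\<phi> p)\<^sup>2) \<le> E / 16" using \<open>X \<le> E\<close> X0
    by (simp add: power2_eq_square)
  have "(\<Sum>p\<in>T \<times> T. \<phi> p * g p)\<^sup>2 \<le> (\<Sum>p\<in>T \<times> T. (\<phi> p)\<^sup>2) * E"
    unfolding E_def by (rule Cauchy_Schwarz_ineq_sum)
  also have "\<dots> \<le> (E / 16) * E" using \<phi>E E0 by (rule mult_right_mono)
  also have "\<dots> = (E / 4)\<^sup>2" by (simp add: power2_eq_square)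
  finally have cross: "(\<Sum>p\<in>T \<times> T. \<phi> p * g p) \<le> E / 4"
    by (rule power2_le_imp_le) (use E0 in simp)
  have "(\<Sum>p\<in>{p\<in>T \<times> T. bipotential \<nu> p \<le> M / 100}. (g p)\<^sup>2) = (\<Sum>p\<in>T \<times> T. f p * g p)"
    unfolding sum.inter_filter[OF finP] by (intro sum.cong) (auto simp: f_def power2_eq_square)
  also have "\<dots> = (\<Sum>\<omega>\<in>L \<times> L. \<nu> \<omega> * up_sum (T \<times> T) f \<omega>)"
    unfolding g_def by (rule sum_up_sum_eq_sum_down_sum[OF finB finP, symmetric])
  also have "\<dots> \<le> (\<Sum>\<omega>\<in>L \<times> L. \<nu> \<omega> * (up_sum (T \<times> T) \<phi> \<omega> + M))"
    using \<phi>(2) \<nu> by (intro sum_mono mult_left_mono) auto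
  also have "\<dots> = (\<Sum>p\<in>T \<times> T. \<phi> p * g p) + M * sum \<nu> (L \<times> L)"
    unfolding g_def sum_up_sum_eq_sum_down_sum[OF finB finP, symmetric]
    by (simp add: distrib_left sum.distrib sum_distrib_left mult.commute)
  finally show ?thesis using cross by (simp add: E_def)
qed


section \<open>Carleson sums control the energy of restrictions\<close>
definition bienergy :: "('a \<times> 'a \<Rightarrow> real) \<Rightarrow> real" where
  "bienergy \<nu> = (\<Sum>p\<in>T \<times> T. (down_sum (L \<times> L) \<nu> p)\<^sup>2)"

lemma mutual_energy_square_le:
  "(\<Sum>\<omega>\<in>L \<times> L. \<mu> \<omega> * bipotential \<nu> \<omega>)\<^sup>2 \<le> bienergy \<nu> * bienergy \<mu>"
proof -
  have "(\<Sum>\<omega>\<in>L \<times> L. \<mu> \<omega> * bipotential \<nu> \<omega>)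
      = (\<Sum>p\<in>T \<times> T. down_sum (L \<times> L) \<nu> p * down_sum (L \<times> L) \<mu> p)"
    unfolding bipotential_def using finite_nodes finite_leaves
    by (intro sum_up_sum_eq_sum_down_sum) auto
  then show ?thesis by (simp add: bienergy_def Cauchy_Schwarz_ineq_sum)
qed

text \<open>Apply the small energy bound to an extremal restriction \<open>\<nu>\<close> of energy \<open>A m\<close>, where \<open>m\<close> is its mass. With
  \<open>M = A / 4\<close> both terms of \<open>small_energy_le\<close> equal \<open>A m / 4\<close>, so half of the energy sits at potential
  above \<open>A / 400\<close>. Extremality is used a second time to bound the energy of \<open>\<mu>\<close> restricted to \<open>F\<close>, a
  set that need not lie in the extremal one; that yields \<open>\<mu>(F) \<le> 400\<^sup>2 m\<close>.\<close>
lemma restricted_energy_le: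
  fixes \<mu> :: "'a \<times> 'a \<Rightarrow> real"
  defines "B \<equiv> L \<times> L"
  assumes \<mu>: "\<And>\<omega>. \<omega> \<in> B \<Longrightarrow> 0 \<le> \<mu> \<omega>" and C: "0 \<le> C"
    and carleson: "\<And>F. F \<subseteq> B \<Longrightarrow>
      (\<Sum>p\<in>{p\<in>T \<times> T. \<forall>\<omega>\<in>B. \<omega> \<le> p \<longrightarrow> \<omega> \<in> F}. (down_sum B \<mu> p)\<^sup>2) \<le> C * sum \<mu> F"
    and E: "E \<subseteq> B"
  shows "bienergy (\<lambda>\<omega>. if \<omega> \<in> E then \<mu> \<omega> else 0) \<le> 320000 * C * sum \<mu> E"
proof -
  define cut where "cut F \<omega> = (if \<omega> \<in> F then \<mu> \<omega> else 0)" for F \<omega>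
  have finP: "finite (T \<times> T)" and finB: "finite B"
    using finite_nodes finite_leaves by (auto simp: B_def)
  have finF: "finite F" if "F \<subseteq> B" for F using finB that finite_subset by blast
  have sum0: "0 \<le> sum \<mu> F" if "F \<subseteq> B" for F using that \<mu> by (intro sum_nonneg) auto
  have cut0: "0 \<le> cut F \<omega>" "cut F \<omega> \<le> \<mu> \<omega>" if "\<omega> \<in> B" for F \<omega>
    using \<mu> that by (auto simp: cut_def)
  have sum_cut: "sum (cut F) B = sum \<mu> F" if "F \<subseteq> B" for F
    unfolding cut_def using that finB by (simp add: Int_absorb1 flip: sum.inter_restrict)
  have null: "bienergy (cut F) = 0" if F: "F \<subseteq> B" "sum \<mu> F = 0" for F
  proof -
    have "\<forall>\<omega>\<in>F. \<mu> \<omega> = 0"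
      using F finF \<mu> sum_nonneg_eq_0_iff[of F \<mu>] by blast
    then have "cut F = (\<lambda>_. 0)" by (auto simp: cut_def)
    then show ?thesis by (simp add: bienergy_def down_sum_def)
  qed
  define S where "S = {F. F \<subseteq> B \<and> 0 < sum \<mu> F}"
  show ?thesis
  proof (cases "S = {}")
    case True
    then have "E \<notin> S" by simp
    then have "sum \<mu> E = 0" using E sum0[OF E] by (simp add: S_def)
    then show ?thesis using null[OF E] by (simp add: cut_def[abs_def])
  next
    case False
    let ?ratio = "\<lambda>F. bienergy (cut F) / sum \<mu> F"
    define A where "A = Max (?ratio ` S)"
    have finS: "finite S" unfolding S_def using finB by simp
    have A_max: "bienergy (cut F) \<le> A * sum \<mu> F" if F: "F \<subseteq> B" for F
    proof (cases "sum \<mu> F = 0")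
      case False
      then have pos: "0 < sum \<mu> F" using sum0[OF F] by simp
      then have "?ratio F \<le> A" unfolding A_def using F finS by (intro Max_ge) (auto simp: S_def)
      then show ?thesis using pos by (simp add: field_simps)
    qed (use null F in simp)
    have "A \<in> ?ratio ` S" unfolding A_def using finS False by (intro Max_in) auto
    then obtain E0 where E0: "E0 \<subseteq> B" "0 < sum \<mu> E0" "?ratio E0 = A"
      unfolding S_def by blast
    let ?m = "sum \<mu> E0" and ?\<nu> = "cut E0"
    have en: "bienergy ?\<nu> = A * ?m" using E0 by (auto simp: field_simps)
    have "A \<le> 320000 * C"
    proof (cases "A \<le> 0")
      case True
      then show ?thesis using C by simp
    next
      case False
      then have A: "0 < A" by simp
      let ?V = "bipotential ?\<nu>" and ?g = "down_sum B ?\<nu>"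
      define F where "F = {\<omega>\<in>B. A / 400 < ?V \<omega>}"
      have FB: "F \<subseteq> B" by (auto simp: F_def)
      have g0: "0 \<le> ?g p" for p using cut0 by (intro down_sum_nonneg) auto
      \<comment> \<open>At least half of the extremal energy comes from nodes of large potential, to which the
        Carleson condition applies.\<close>
      have "(\<Sum>p\<in>{p\<in>T \<times> T. ?V p \<le> A / 400}. (?g p)\<^sup>2) \<le> A * ?m / 2"
        using small_energy_le[of ?\<nu> "A / 4"] cut0 A sum_cut[OF E0(1)] en
        by (simp add: B_def bienergy_def)
      moreover have "(\<Sum>p\<in>T \<times> T. (?g p)\<^sup>2) = (\<Sum>p\<in>{p\<in>T \<times> T. ?V p \<le> A / 400}. (?g p)\<^sup>2)
          + (\<Sum>p\<in>{p\<in>T \<times> T. A / 400 < ?V p}. (?g p)\<^sup>2)"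
        using finP by (subst sum.union_disjoint[symmetric]) (auto intro!: sum.cong)
      ultimately have "A * ?m / 2 \<le> (\<Sum>p\<in>{p\<in>T \<times> T. A / 400 < ?V p}. (?g p)\<^sup>2)"
        using en by (simp add: bienergy_def B_def)
      also have "\<dots> \<le> (\<Sum>p\<in>{p\<in>T \<times> T. A / 400 < ?V p}. (down_sum B \<mu> p)\<^sup>2)"
        using g0 finB cut0 by (intro sum_mono power_mono down_sum_mono) auto
      also have "\<dots> \<le> (\<Sum>p\<in>{p\<in>T \<times> T. \<forall>\<omega>\<in>B. \<omega> \<le> p \<longrightarrow> \<omega> \<in> F}. (down_sum B \<mu> p)\<^sup>2)"
      proof (rule sum_mono2)
        have "A / 400 < ?V \<omega>" if "A / 400 < ?V p" "\<omega> \<le> p" for p \<omega>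
        proof -
          have "?V p \<le> ?V \<omega>" unfolding bipotential_def
            using finP g0 that(2) by (intro up_sum_antimono) (auto simp: B_def)
          then show ?thesis using that(1) by linarith
        qed
        then show "{p\<in>T \<times> T. A / 400 < ?V p} \<subseteq> {p\<in>T \<times> T. \<forall>\<omega>\<in>B. \<omega> \<le> p \<longrightarrow> \<omega> \<in> F}"
          unfolding F_def by blast
      qed (use finP in auto)
      also have "\<dots> \<le> C * sum \<mu> F" by (rule carleson[OF FB])
      finally have big: "A * ?m / 2 \<le> C * sum \<mu> F" .
      \<comment> \<open>The mass of \<open>F\<close> is at most a constant times that of \<open>E0\<close>, by the mutual energy of the two
        restrictions.\<close>
      have "A / 400 * sum \<mu> F = (\<Sum>\<omega>\<in>B. cut F \<omega> * (A / 400))"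
        by (simp add: sum_cut[OF FB, symmetric] sum_distrib_left mult.commute)
      also have "\<dots> \<le> (\<Sum>\<omega>\<in>B. cut F \<omega> * ?V \<omega>)"
      proof (rule sum_mono)
        fix \<omega> assume \<omega>: "\<omega> \<in> B"
        show "cut F \<omega> * (A / 400) \<le> cut F \<omega> * ?V \<omega>"
        proof (cases "\<omega> \<in> F")
          case True
          then have "A / 400 \<le> ?V \<omega>" by (simp add: F_def)
          then show ?thesis using cut0(1)[OF \<omega>] by (rule mult_left_mono)
        qed (simp add: cut_def)
      qed
      finally have "(A / 400 * sum \<mu> F)\<^sup>2 \<le> (\<Sum>\<omega>\<in>B. cut F \<omega> * ?V \<omega>)\<^sup>2"
        using A sum0[OF FB] by (intro power_mono) auto
      also have "\<dots> \<le> (A * ?m) * bienergy (cut F)"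
        unfolding en[symmetric] B_def by (rule mutual_energy_square_le)
      also have "\<dots> \<le> (A * ?m) * (A * sum \<mu> F)"
        using A E0(2) by (intro mult_left_mono A_max FB) auto
      finally have "A\<^sup>2 * (sum \<mu> F * sum \<mu> F) \<le> A\<^sup>2 * (sum \<mu> F * (160000 * ?m))"
        by (simp add: power2_eq_square field_simps)
      then have "sum \<mu> F * sum \<mu> F \<le> sum \<mu> F * (160000 * ?m)"
        using A by (simp only: mult_le_cancel_left_pos zero_less_power)
      then have "sum \<mu> F \<le> 160000 * ?m"
        using sum0[OF FB] E0(2) by (cases "sum \<mu> F = 0") auto
      then have "A * ?m / 2 \<le> C * (160000 * ?m)"
        using big C mult_left_mono[of "sum \<mu> F" "160000 * ?m" C] by linarith
      then have "?m * A \<le> ?m * (320000 * C)" by (simp add: mult_ac)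
      then show ?thesis using E0(2) by (simp only: mult_le_cancel_left_pos)
    qed
    then have "A * sum \<mu> E \<le> 320000 * C * sum \<mu> E"
      using sum0[OF E] by (intro mult_right_mono) auto
    then show ?thesis using A_max[OF E] by (simp add: cut_def[abs_def])
  qed
qed

end

section \<open>Dyadic intervals and rectangles\<close>
lemma dyadic_interval_subset_iff:
  "{real m / 2 ^ k .. (real m + 1) / 2 ^ k} \<subseteq> {real a / 2 ^ i .. (real a + 1) / 2 ^ i}
    \<longleftrightarrow> real a / 2 ^ i \<le> real m / 2 ^ k \<and> (real m + 1) / 2 ^ k \<le> (real a + 1) / 2 ^ i"
  by (simp add: divide_right_mono)

lemma dyadic_fraction_refine:
  assumes "i \<le> j"
  shows "real a / 2 ^ i = real (a * 2 ^ (j - i)) / 2 ^ j"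
proof -
  have "(2::real) ^ j = 2 ^ i * 2 ^ (j - i)" using assms by (simp flip: power_add)
  then show ?thesis by simp
qed

text \<open>Dyadic intervals that overlap in more than a point are nested: in units of the finer mesh all
  endpoints are integers, so the strict inequalities improve by one.\<close>
lemma dyadic_endpoints_le:
  assumes "i \<le> j" "real a / 2 ^ i < (real b + 1) / 2 ^ j" "real b / 2 ^ j < (real a + 1) / 2 ^ i"
  shows "real a / 2 ^ i \<le> real b / 2 ^ j \<and> (real b + 1) / 2 ^ j \<le> (real a + 1) / 2 ^ i"
proof -
  note refine = dyadic_fraction_refine[OF assms(1)]
  have "real (a * 2 ^ (j - i)) < real (b + 1)" "real b < real ((a + 1) * 2 ^ (j - i))"
    using assms(2,3) refine[of a] refine[of "a + 1"]
    by (simp_all add: divide_less_cancel add.commute del: of_nat_mult)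
  then have "a * 2 ^ (j - i) < b + 1" "b < (a + 1) * 2 ^ (j - i)"
    unfolding of_nat_less_iff .
  then have "a * 2 ^ (j - i) \<le> b" "b + 1 \<le> (a + 1) * 2 ^ (j - i)" by simp_all
  then have "real (a * 2 ^ (j - i)) \<le> real b" "real (b + 1) \<le> real ((a + 1) * 2 ^ (j - i))"
    unfolding of_nat_le_iff .
  then show ?thesis using refine[of a] refine[of "a + 1"]
    by (simp add: divide_le_cancel add.commute del: of_nat_mult)
qed

lemma dyadic_intervals_nested:
  assumes x: "x \<in> dyadic_intervals k" and a: "A \<in> dyadic_intervals i" and b: "B \<in> dyadic_intervals j"
    and sub: "x \<subseteq> A" "x \<subseteq> B" and ij: "i \<le> j"
  shows "B \<subseteq> A"
proof -
  obtain m a b where xab: "x = {real m / 2 ^ k .. (real m + 1) / 2 ^ k}"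
    "A = {real a / 2 ^ i .. (real a + 1) / 2 ^ i}" "B = {real b / 2 ^ j .. (real b + 1) / 2 ^ j}"
    using x a b by (auto simp: dyadic_intervals_def)
  have "real m / 2 ^ k < (real m + 1) / 2 ^ k" by (simp add: divide_strict_right_mono)
  then show ?thesis
    using dyadic_endpoints_le[OF ij, of a b] sub unfolding xab dyadic_interval_subset_iff by linarith
qed

lemma dyadic_interval_covered:
  assumes "A \<in> dyadic_intervals i" "i \<le> N" "p \<in> A"
  obtains x where "x \<in> dyadic_intervals N" "x \<subseteq> A" "p \<in> x"
proof -
  obtain a where a: "a < 2 ^ i" and A: "A = {real a / 2 ^ i .. (real a + 1) / 2 ^ i}"
    using assms(1) by (auto simp: dyadic_intervals_def)
  define q where "q = p * 2 ^ N"
  note refine = dyadic_fraction_refine[OF assms(2)]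
  have "real a / 2 ^ i \<le> p" "p \<le> real (a + 1) / 2 ^ i"
    using assms(3) unfolding A by (simp_all add: add.commute)
  then have q: "real (a * 2 ^ (N - i)) \<le> q" "q \<le> real ((a + 1) * 2 ^ (N - i))"
    unfolding q_def refine by (simp_all only: pos_divide_le_eq pos_le_divide_eq zero_less_power zero_less_numeral)
  have q0: "0 \<le> q" using q(1) by (rule order_trans[rotated]) simp
  \<comment> \<open>The minimum is needed when \<open>p\<close> is the right endpoint of \<open>A\<close>.\<close>
  define m where "m = min (nat \<lfloor>q\<rfloor>) ((a + 1) * 2 ^ (N - i) - 1)"
  have pos: "1 \<le> (2::nat) ^ (N - i)" by simp
  have m1: "a * 2 ^ (N - i) \<le> m"
  proof -
    have "a * 2 ^ (N - i) \<le> nat \<lfloor>q\<rfloor>" using q(1) by (rule le_nat_floor)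
    moreover have "a * 2 ^ (N - i) \<le> (a + 1) * 2 ^ (N - i) - 1"
      using pos unfolding distrib_right by linarith
    ultimately show ?thesis by (simp add: m_def)
  qed
  have m2: "m + 1 \<le> (a + 1) * 2 ^ (N - i)"
  proof -
    have "m \<le> (a + 1) * 2 ^ (N - i) - 1" by (simp only: m_def min.cobounded2)
    then show ?thesis using pos unfolding distrib_right by linarith
  qed
  have m3: "real m \<le> q"
  proof -
    have "real m \<le> real (nat \<lfloor>q\<rfloor>)" by (simp only: m_def of_nat_le_iff min.cobounded1)
    also have "\<dots> \<le> q" using q0 by simp
    finally show ?thesis .
  qed
  have m4: "q \<le> real m + 1"
  proof (cases "nat \<lfloor>q\<rfloor> \<le> (a + 1) * 2 ^ (N - i) - 1")
    case True
    then have "m = nat \<lfloor>q\<rfloor>" by (simp only: m_def min_def if_True)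
    then show ?thesis using q0 by linarith
  next
    case False
    then have "m + 1 = (a + 1) * 2 ^ (N - i)" unfolding m_def using pos by simp
    then show ?thesis using q(2) by (metis of_nat_1 of_nat_add)
  qed
  have "(a + 1) * 2 ^ (N - i) \<le> 2 ^ i * 2 ^ (N - i)" using a by (intro mult_right_mono) auto
  then have "m < 2 ^ N" using m2 assms(2) by (simp flip: power_add)
  then have "{real m / 2 ^ N .. (real m + 1) / 2 ^ N} \<in> dyadic_intervals N"
    by (auto simp: dyadic_intervals_def)
  moreover have "{real m / 2 ^ N .. (real m + 1) / 2 ^ N} \<subseteq> A"
  proof -
    have "real (a * 2 ^ (N - i)) \<le> real m" "real (m + 1) \<le> real ((a + 1) * 2 ^ (N - i))"
      using m1 m2 unfolding of_nat_le_iff by auto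
    then show ?thesis unfolding A dyadic_interval_subset_iff using refine[of a] refine[of "a + 1"]
      by (simp add: divide_le_cancel add.commute del: of_nat_mult)
  qed
  moreover have "p \<in> {real m / 2 ^ N .. (real m + 1) / 2 ^ N}"
    using m3 m4 unfolding q_def by (simp add: field_simps)
  ultimately show ?thesis using that by blast
qed

text \<open>Closed dyadic intervals of equal length may share endpoints, but the midpoint of an interval
  belongs to no other.\<close>
lemma dyadic_interval_has_private_point:
  assumes "x \<in> dyadic_intervals N"
  obtains c where "c \<in> x" "\<And>y. y \<in> dyadic_intervals N \<Longrightarrow> c \<in> y \<Longrightarrow> y = x"
proof -
  obtain m where x: "x = {real m / 2 ^ N .. (real m + 1) / 2 ^ N}"
    using assms by (auto simp: dyadic_intervals_def)
  define c where "c = (real m + 1/2) / 2 ^ N"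
  have "c \<in> x" unfolding x c_def by (simp add: divide_right_mono)
  moreover have "y = x" if y_dyadic: "y \<in> dyadic_intervals N" and c_in: "c \<in> y" for y
  proof -
    obtain n where y: "y = {real n / 2 ^ N .. (real n + 1) / 2 ^ N}"
      using y_dyadic by (auto simp: dyadic_intervals_def)
    have "real n \<le> real m + 1/2" "real m + 1/2 \<le> real n + 1"
      using c_in unfolding y c_def by (simp_all add: divide_le_cancel)
    then have "n = m" by linarith
    then show ?thesis using x y by simp
  qed
  ultimately show ?thesis using that by blast
qed

lemma dyadic_interval_nonempty: "A \<in> dyadic_intervals k \<Longrightarrow> A \<noteq> {}"
  by (auto simp: dyadic_intervals_def divide_le_cancel)

lemma node_le_iff:
  assumes "\<omega> \<in> bitree_boundary N"
  shows "node_le \<omega> \<alpha> \<longleftrightarrow> \<omega> \<le> \<alpha>"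
proof -
  have "fst \<omega> \<noteq> {}" "snd \<omega> \<noteq> {}"
    using assms by (auto simp: bitree_boundary_def dest: dyadic_interval_nonempty)
  then show ?thesis by (simp add: node_le_def rect_def times_subset_iff less_eq_prod_def)
qed

text \<open>Turns the geometric inclusion in \<open>U\<^sub>F\<close> into a condition on the order of nodes. If the
  rectangle lies in \<open>U\<^sub>F\<close>, the private points of each boundary square below it force that square into \<open>F\<close>;
  conversely a rectangle is the union of the boundary squares below it.\<close>
lemma rects_in_eq:
  assumes F: "F \<subseteq> bitree_boundary N"
  shows "rects_in N F = {\<alpha> \<in> bitree N. \<forall>\<omega>\<in>bitree_boundary N. \<omega> \<le> \<alpha> \<longrightarrow> \<omega> \<in> F}"
proof (intro equalityI subsetI)
  fix \<alpha> assume "\<alpha> \<in> rects_in N F"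
  then have \<alpha>: "\<alpha> \<in> bitree N" "rect \<alpha> \<subseteq> region F" by (auto simp: rects_in_def)
  have "\<omega> \<in> F" if \<omega>: "\<omega> \<in> bitree_boundary N" "\<omega> \<le> \<alpha>" for \<omega>
  proof -
    obtain x y where xy: "\<omega> = (x, y)" "x \<in> dyadic_intervals N" "y \<in> dyadic_intervals N"
      using \<omega> by (auto simp: bitree_boundary_def)
    obtain c where c: "c \<in> x" "\<And>z. z \<in> dyadic_intervals N \<Longrightarrow> c \<in> z \<Longrightarrow> z = x"
      using dyadic_interval_has_private_point[OF xy(2)] by blast
    obtain d where d: "d \<in> y" "\<And>z. z \<in> dyadic_intervals N \<Longrightarrow> d \<in> z \<Longrightarrow> z = y"
      using dyadic_interval_has_private_point[OF xy(3)] by blast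
    have "(c, d) \<in> rect \<alpha>" using \<omega>(2) c(1) d(1) xy(1) by (auto simp: rect_def less_eq_prod_def)
    then obtain \<omega>' where \<omega>': "\<omega>' \<in> F" "c \<in> fst \<omega>'" "d \<in> snd \<omega>'"
      using \<alpha>(2) by (auto simp: region_def rect_def)
    moreover have "fst \<omega>' \<in> dyadic_intervals N" "snd \<omega>' \<in> dyadic_intervals N"
      using F \<omega>'(1) by (auto simp: bitree_boundary_def)
    ultimately have "fst \<omega>' = x" "snd \<omega>' = y" using c(2) d(2) by blast+
    then have "\<omega>' = \<omega>" unfolding xy(1) by (rule prod_eqI[of _ "(x, y)", simplified])
    then show ?thesis using \<omega>' by simp
  qed
  then show "\<alpha> \<in> {\<alpha> \<in> bitree N. \<forall>\<omega>\<in>bitree_boundary N. \<omega> \<le> \<alpha> \<longrightarrow> \<omega> \<in> F}" using \<alpha> by blast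
next
  fix \<alpha> assume "\<alpha> \<in> {\<alpha> \<in> bitree N. \<forall>\<omega>\<in>bitree_boundary N. \<omega> \<le> \<alpha> \<longrightarrow> \<omega> \<in> F}"
  then have \<alpha>: "\<alpha> \<in> bitree N" "\<And>\<omega>. \<omega> \<in> bitree_boundary N \<Longrightarrow> \<omega> \<le> \<alpha> \<Longrightarrow> \<omega> \<in> F" by auto
  have "r \<in> region F" if "r \<in> rect \<alpha>" for r
  proof -
    obtain s t where r: "r = (s, t)" "s \<in> fst \<alpha>" "t \<in> snd \<alpha>" using \<open>r \<in> rect \<alpha>\<close> by (auto simp: rect_def)
    obtain i j where ij: "i \<le> N" "fst \<alpha> \<in> dyadic_intervals i" "j \<le> N" "snd \<alpha> \<in> dyadic_intervals j"
      using \<alpha>(1) by (auto simp: bitree_def dyadic_tree_def)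
    obtain x where x: "x \<in> dyadic_intervals N" "x \<subseteq> fst \<alpha>" "s \<in> x"
      using dyadic_interval_covered[OF ij(2,1) r(2)] .
    obtain y where y: "y \<in> dyadic_intervals N" "y \<subseteq> snd \<alpha>" "t \<in> y"
      using dyadic_interval_covered[OF ij(4,3) r(3)] .
    note xy = x y
    then have "(x, y) \<in> F" using \<alpha>(2)[of "(x, y)"] by (auto simp: bitree_boundary_def less_eq_prod_def)
    moreover have "r \<in> rect (x, y)" using r(1) xy by (simp add: rect_def)
    ultimately show ?thesis unfolding region_def by blast
  qed
  then show "\<alpha> \<in> rects_in N F" using \<alpha>(1) by (auto simp: rects_in_def)
qed

section \<open>The equivalence\<close>
lemma finite_forest_dyadic: "finite_forest (dyadic_tree N) (dyadic_intervals N)"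
proof
  show "finite (dyadic_tree N)" by (simp add: dyadic_tree_def finite_dyadic_intervals)
  show "dyadic_intervals N \<subseteq> dyadic_tree N" by (auto simp: dyadic_tree_def)
  fix x a b assume "x \<in> dyadic_tree N" "a \<in> dyadic_tree N" "b \<in> dyadic_tree N"
    and sub: "x \<subseteq> a" "x \<subseteq> b"
  then obtain k i j where
    "x \<in> dyadic_intervals k" "a \<in> dyadic_intervals i" "b \<in> dyadic_intervals j"
    by (auto simp: dyadic_tree_def)
  then show "a \<subseteq> b \<or> b \<subseteq> a"
    using dyadic_intervals_nested[of x k a i b j] dyadic_intervals_nested[of x k b j a i] sub
    by (cases "i \<le> j") auto
qed

lemma rect_mass_eq_down_sum: "rect_mass N \<mu> \<alpha> = down_sum (bitree_boundary N) \<mu> \<alpha>"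
  unfolding rect_mass_def down_sum_def by (intro sum.cong) (auto simp: node_le_iff)

lemma carleson_imp_restriction_energy_condition:
  assumes "boundary_measure N \<mu>" "0 \<le> C" "carleson N C \<mu>"
  shows "restriction_energy_condition N (320000 * C) \<mu>"
proof -
  interpret finite_forest "dyadic_tree N" "dyadic_intervals N" by (rule finite_forest_dyadic)
  have energy: "energy N \<nu> = bienergy \<nu>" for \<nu>
    by (simp add: energy_def bienergy_def bitree_def bitree_boundary_def rect_mass_eq_down_sum)
  have "energy N (restrict_measure \<mu> E) \<le> 320000 * C * sum \<mu> E" if "E \<subseteq> bitree_boundary N" for E
    unfolding energy restrict_measure_def
  proof (rule restricted_energy_le[folded bitree_def bitree_boundary_def])
    fix F assume F: "F \<subseteq> bitree_boundary N"
    then have "(\<Sum>R\<in>rects_in N F. (rect_mass N \<mu> R)\<^sup>2) \<le> C * sum \<mu> F"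
      using assms(3) by (simp add: carleson_def)
    then show "(\<Sum>p\<in>{p \<in> bitree N. \<forall>\<omega>\<in>bitree_boundary N. \<omega> \<le> p \<longrightarrow> \<omega> \<in> F}.
        (down_sum (bitree_boundary N) \<mu> p)\<^sup>2) \<le> C * sum \<mu> F"
      unfolding rects_in_eq[OF F] rect_mass_eq_down_sum .
  qed (use assms that in \<open>auto simp: boundary_measure_def\<close>)
  then show ?thesis by (simp add: restriction_energy_condition_def)
qed

lemma rect_mass_restrict_measure:
  assumes "F \<subseteq> bitree_boundary N" "R \<in> rects_in N F"
  shows "rect_mass N (restrict_measure \<mu> F) R = rect_mass N \<mu> R"
  using assms unfolding rect_mass_eq_down_sum down_sum_def
  by (intro sum.cong) (auto simp: rects_in_eq restrict_measure_def)

lemma sum_restrict_measure: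
  "finite F \<Longrightarrow> sum (restrict_measure \<mu> E) F = sum \<mu> (E \<inter> F)"
  unfolding restrict_measure_def by (simp add: Int_commute[of E] sum.inter_restrict)

text \<open>The Carleson sum is part of the sum that defines the energy of the restriction, because a rectangle inside
  \<open>U\<^sub>F\<close> sees only the mass on \<open>F\<close>.\<close>
lemma sum_rects_in_le_energy:
  assumes "F \<subseteq> bitree_boundary N"
  shows "(\<Sum>R\<in>rects_in N F. (rect_mass N \<nu> R)\<^sup>2) \<le> energy N (restrict_measure \<nu> F)"
proof -
  have "(\<Sum>R\<in>rects_in N F. (rect_mass N \<nu> R)\<^sup>2)
      = (\<Sum>R\<in>rects_in N F. (rect_mass N (restrict_measure \<nu> F) R)\<^sup>2)"
    using assms by (intro sum.cong) (simp_all add: rect_mass_restrict_measure)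
  also have "\<dots> \<le> energy N (restrict_measure \<nu> F)"
    unfolding energy_def using finite_bitree by (intro sum_mono2) (auto simp: rects_in_def)
  finally show ?thesis .
qed

lemma restriction_energy_condition_imp_hereditary_carleson:
  assumes "restriction_energy_condition N C \<mu>"
  shows "hereditary_carleson N C \<mu>"
  unfolding hereditary_carleson_def carleson_def
proof (intro allI impI)
  fix E F assume E: "E \<subseteq> bitree_boundary N" and F: "F \<subseteq> bitree_boundary N"
  have "restrict_measure (restrict_measure \<mu> E) F = restrict_measure \<mu> (E \<inter> F)"
    by (auto simp: restrict_measure_def)
  then have "(\<Sum>R\<in>rects_in N F. (rect_mass N (restrict_measure \<mu> E) R)\<^sup>2)
      \<le> energy N (restrict_measure \<mu> (E \<inter> F))"
    using sum_rects_in_le_energy[OF F, of "restrict_measure \<mu> E"] by simp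
  also have "\<dots> \<le> C * sum \<mu> (E \<inter> F)"
    using assms le_infI1[OF E, of F] by (simp add: restriction_energy_condition_def)
  also have "sum \<mu> (E \<inter> F) = sum (restrict_measure \<mu> E) F"
    using finite_subset[OF F finite_bitree_boundary] by (simp add: sum_restrict_measure)
  finally show "(\<Sum>R\<in>rects_in N F. (rect_mass N (restrict_measure \<mu> E) R)\<^sup>2)
      \<le> C * sum (restrict_measure \<mu> E) F" .
qed

lemma hereditary_carleson_imp_carleson:
  assumes "hereditary_carleson N C \<mu>"
  shows "carleson N C \<mu>"
  unfolding carleson_def
proof (intro allI impI)
  fix F assume F: "F \<subseteq> bitree_boundary N"
  have "(\<Sum>R\<in>rects_in N F. (rect_mass N \<mu> R)\<^sup>2)
      = (\<Sum>R\<in>rects_in N F. (rect_mass N (restrict_measure \<mu> F) R)\<^sup>2)"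
    using F by (intro sum.cong) (simp_all add: rect_mass_restrict_measure)
  also have "\<dots> \<le> C * sum (restrict_measure \<mu> F) F"
    using assms F by (simp add: hereditary_carleson_def carleson_def)
  also have "sum (restrict_measure \<mu> F) F = sum \<mu> F"
    using finite_subset[OF F finite_bitree_boundary] by (simp add: sum_restrict_measure)
  finally show "(\<Sum>R\<in>rects_in N F. (rect_mass N \<mu> R)\<^sup>2) \<le> C * sum \<mu> F" .
qed

lemma carleson_mono:
  assumes "carleson N C \<nu>" "C \<le> D" "boundary_measure N \<nu>"
  shows "carleson N D \<nu>"
  unfolding carleson_def
proof (intro allI impI)
  fix F assume F: "F \<subseteq> bitree_boundary N"
  then have "0 \<le> sum \<nu> F" using assms(3) by (auto simp: boundary_measure_def intro!: sum_nonneg)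
  then have "C * sum \<nu> F \<le> D * sum \<nu> F" using assms(2) by (rule mult_right_mono[rotated])
  moreover have "(\<Sum>R\<in>rects_in N F. (rect_mass N \<nu> R)\<^sup>2) \<le> C * sum \<nu> F"
    using assms(1) F by (simp add: carleson_def)
  ultimately show "(\<Sum>R\<in>rects_in N F. (rect_mass N \<nu> R)\<^sup>2) \<le> D * sum \<nu> F" by linarith
qed

lemma restriction_energy_condition_mono:
  assumes "restriction_energy_condition N C \<mu>" "C \<le> D" "boundary_measure N \<mu>"
  shows "restriction_energy_condition N D \<mu>"
  unfolding restriction_energy_condition_def
proof (intro allI impI)
  fix E assume E: "E \<subseteq> bitree_boundary N"
  then have "0 \<le> sum \<mu> E" using assms(3) by (auto simp: boundary_measure_def intro!: sum_nonneg)
  then have "C * sum \<mu> E \<le> D * sum \<mu> E" using assms(2) by (rule mult_right_mono[rotated])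
  moreover have "energy N (restrict_measure \<mu> E) \<le> C * sum \<mu> E"
    using assms(1) E by (simp add: restriction_energy_condition_def)
  ultimately show "energy N (restrict_measure \<mu> E) \<le> D * sum \<mu> E" by linarith
qed

theorem theorem1p8:
  shows "\<forall>C::real. \<exists>C'>0. \<forall>N\<ge>1. \<forall>\<mu>. boundary_measure N \<mu> \<longrightarrow>
    (carleson N C \<mu> \<longrightarrow>
       restriction_energy_condition N C' \<mu> \<and> hereditary_carleson N C' \<mu>) \<and>
    (restriction_energy_condition N C \<mu> \<longrightarrow>
       carleson N C' \<mu> \<and> hereditary_carleson N C' \<mu>) \<and>
    (hereditary_carleson N C \<mu> \<longrightarrow>
       carleson N C' \<mu> \<and> restriction_energy_condition N C' \<mu>)"
proof
  fix C :: real
  \<comment> \<open>The hypotheses may hold with a constant \<open>C \<le> 0\<close>; the maximum keeps the new constant positive.\<close>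
  define D where "D = max C 1"
  let ?D' = "320000 * D"
  have D: "C \<le> D" "0 \<le> D" "0 < ?D'" by (auto simp: D_def)
  show "\<exists>C'>0. \<forall>N\<ge>1. \<forall>\<mu>. boundary_measure N \<mu> \<longrightarrow>
    (carleson N C \<mu> \<longrightarrow>
       restriction_energy_condition N C' \<mu> \<and> hereditary_carleson N C' \<mu>) \<and>
    (restriction_energy_condition N C \<mu> \<longrightarrow>
       carleson N C' \<mu> \<and> hereditary_carleson N C' \<mu>) \<and>
    (hereditary_carleson N C \<mu> \<longrightarrow>
       carleson N C' \<mu> \<and> restriction_energy_condition N C' \<mu>)"
  proof (intro exI[of _ ?D'] conjI[OF D(3)] allI impI)
    fix N \<mu> assume \<mu>: "boundary_measure N \<mu>"
    have b_to_a: "carleson N c \<mu>" if "restriction_energy_condition N c \<mu>" for c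
      using that restriction_energy_condition_imp_hereditary_carleson hereditary_carleson_imp_carleson
      by blast
    have "restriction_energy_condition N ?D' \<mu>"
      if "carleson N C \<mu> \<or> restriction_energy_condition N C \<mu> \<or> hereditary_carleson N C \<mu>"
    proof -
      have "carleson N C \<mu>"
        using that b_to_a hereditary_carleson_imp_carleson by blast
      then have "carleson N D \<mu>" using D(1) \<mu> by (rule carleson_mono)
      then show ?thesis using D(2) \<mu> by (intro carleson_imp_restriction_energy_condition)
    qed
    then show "(carleson N C \<mu> \<longrightarrow>
         restriction_energy_condition N ?D' \<mu> \<and> hereditary_carleson N ?D' \<mu>) \<and>
      (restriction_energy_condition N C \<mu> \<longrightarrow>
         carleson N ?D' \<mu> \<and> hereditary_carleson N ?D' \<mu>) \<and>
      (hereditary_carleson N C \<mu> \<longrightarrow>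
         carleson N ?D' \<mu> \<and> restriction_energy_condition N ?D' \<mu>)"
      using b_to_a restriction_energy_condition_imp_hereditary_carleson by blast
  qed
qed

end
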